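(* Let $\mathcal{I}\subset\mathbb{N}_0$ be a finite discrete interval with $k_0\in\mathcal{I}$. The following statements are equivalent: (i) $\operatorname{rank}\varphi(\mathcal{I})=2n$. (ii) $\ker\varphi(\mathcal{I})=\{0\}$. (iii) For some $\lambda\in\mathbb{C}$, every nontrivial solution $z(\lambda)$ of (S$_\lambda$) satisfies $\sum_{k\in\mathcal{I}}z_k^*(\lambda)\Psi_k z_k(\lambda)>0$. (iv) For some $\lambda\in\mathbb{C}$, every solution $z(\lambda)$ of (S$_\lambda$) with $\sum_{k\in\mathcal{I}}z_k^*(\lambda)\Psi_k z_k(\lambda)=0$ is trivial, i.e. $z_k(\lambda)=0$ for $k\in\mathcal{I}$.
   Context: Let $n\in\mathbb{N}$, $\mathbb{N}_0=\{0,1,2,\dots\}$ and $\mathcal{J}=\begin{pmatrix}0&I_n\\-I_n&0\end{pmatrix}$. For each $k\in\mathbb{N}_0$ let $S_k,\Psi_k\in\mathbb{C}^{2n\times2n}$ satisfy $S_k^*\mathcal{J}S_k=\mathcal{J}$, $\Psi_k^*=\Psi_k\ge0$ (positive semi-definite) and $\Psi_k\mathcal{J}\Psi_k=0$. Put $V_k=-\mathcal{J}\Psi_kS_k$ and $\mathbb{S}_k(\lambda)=S_k+\lambda V_k$, $\lambda\in\mathbb{C}$; these matrices are invertible. System (S$_\lambda$) is $z_k(\lambda)=\mathbb{S}_k(\lambda)z_{k+1}(\lambda)$, $k\in\mathbb{N}_0$; a solution (unless said otherwise) is a sequence $(z_k)_{k\in\mathbb{N}_0}$ in $\mathbb{C}^{2n}$.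 A discrete interval is a nonempty set of the form $\mathcal{I}=I\cap\mathbb{Z}$ with $I$ a real interval. Fix $k_0\in\mathbb{N}_0$ and, for each $\lambda\in\mathbb{C}$, let $\Phi(\lambda)$ be the $2n\times2n$ matrix solution of (S$_\lambda$) with $\Phi_{k_0}(\lambda)=I_{2n}$. For a finite discrete interval $\mathcal{I}\subset\mathbb{N}_0$ with $k_0\in\mathcal{I}$ put $\varphi(\lambda,\mathcal{I})=\sum_{k\in\mathcal{I}}\Phi_k^*(\lambda)\Psi_k\Phi_k(\lambda)$. Its kernel, range and rank do not depend on $\lambda$ and are denoted $\ker\varphi(\mathcal{I})$, $\operatorname{ran}\varphi(\mathcal{I})$, $\operatorname{rank}\varphi(\mathcal{I})$. *)

theory Defs
  imports "HOL-Analysis.Analysis" "HOL-Library.Complex_Order"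
begin

text \<open>
  Vectors in \<open>\<complex>\<^sup>2\<^sup>n\<close> and \<open>2n \<times> 2n\<close> matrices are indexed by the sum type
  \<open>'n + 'n\<close>, where \<open>n = CARD('n)\<close>; \<open>Inl\<close> and \<open>Inr\<close> select the first and second block.
\<close>

type_synonym 'n vec2 = "complex ^ ('n + 'n)"
type_synonym 'n mat2 = "complex ^ ('n + 'n) ^ ('n + 'n)"

definition ctranspose :: "complex ^ 'n ^ 'm \<Rightarrow> complex ^ 'm ^ 'n" where
  "ctranspose A = (\<chi> i j. cnj (A $ j $ i))"

definition cscale_mat :: "complex \<Rightarrow> complex ^ 'n ^ 'm \<Rightarrow> complex ^ 'n ^ 'm" where
  "cscale_mat c A = (\<chi> i j. c * A $ i $ j)"

text \<open>\<open>quad_form A x\<close> is the complex number \<open>x\<^sup>* A x\<close>. The order on \<^typ>\<open>complex\<close> is the one of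
  \<^theory>\<open>HOL-Library.Complex_Order\<close>: \<open>0 < w\<close> and \<open>0 \<le> w\<close> include the claim that \<open>w\<close> is real.\<close>

definition quad_form :: "complex ^ 'n ^ 'n \<Rightarrow> complex ^ 'n \<Rightarrow> complex" where
  "quad_form A x = (\<Sum>i\<in>UNIV. cnj (x $ i) * (A *v x) $ i)"

definition pos_semidef :: "complex ^ 'n ^ 'n \<Rightarrow> bool" where
  "pos_semidef A \<longleftrightarrow> ctranspose A = A \<and> (\<forall>x. 0 \<le> quad_form A x)"

definition symp_J :: "'n::finite mat2" where
  "symp_J = (\<chi> i j. case (i, j) of
      (Inl a, Inr b) \<Rightarrow> (if a = b then 1 else 0)
    | (Inr a, Inl b) \<Rightarrow> (if a = b then - 1 else 0)
    | _ \<Rightarrow> 0)"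

definition V_mat :: "(nat \<Rightarrow> 'n::finite mat2) \<Rightarrow> (nat \<Rightarrow> 'n mat2) \<Rightarrow> nat \<Rightarrow> 'n mat2" where
  "V_mat S \<Psi> k = - (symp_J ** \<Psi> k ** S k)"

definition S_mat ::
  "(nat \<Rightarrow> 'n::finite mat2) \<Rightarrow> (nat \<Rightarrow> 'n mat2) \<Rightarrow> complex \<Rightarrow> nat \<Rightarrow> 'n mat2" where
  "S_mat S \<Psi> lam k = S k + cscale_mat lam (V_mat S \<Psi> k)"

definition solution ::
  "(nat \<Rightarrow> 'n::finite mat2) \<Rightarrow> (nat \<Rightarrow> 'n mat2) \<Rightarrow> complex \<Rightarrow> (nat \<Rightarrow> 'n vec2) \<Rightarrow> bool" where
  "solution S \<Psi> lam z \<longleftrightarrow> (\<forall>k. z k = S_mat S \<Psi> lam k *v z (Suc k))"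

definition matrix_solution ::
  "(nat \<Rightarrow> 'n::finite mat2) \<Rightarrow> (nat \<Rightarrow> 'n mat2) \<Rightarrow> complex \<Rightarrow> (nat \<Rightarrow> 'n mat2) \<Rightarrow> bool" where
  "matrix_solution S \<Psi> lam Z \<longleftrightarrow> (\<forall>k. Z k = S_mat S \<Psi> lam k ** Z (Suc k))"

text \<open>\<open>\<phi>(lam, \<I>)\<close>, where \<open>\<Phi> lam k\<close> is \<open>\<Phi>\<^sub>k(lam)\<close>.\<close>

definition phi_mat ::
  "(nat \<Rightarrow> 'n::finite mat2) \<Rightarrow> (complex \<Rightarrow> nat \<Rightarrow> 'n mat2) \<Rightarrow> complex \<Rightarrow> nat set \<Rightarrow> 'n mat2" where
  "phi_mat \<Psi> \<Phi> lam I = (\<Sum>k\<in>I. ctranspose (\<Phi> lam k) ** \<Psi> k ** \<Phi> lam k)"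

definition discrete_interval :: "int set \<Rightarrow> bool" where
  "discrete_interval A \<longleftrightarrow>
     A \<noteq> {} \<and> (\<exists>R :: real set. is_interval R \<and> A = {k. real_of_int k \<in> R})"

end

theory Submission
  imports Defs
begin

text \<open>
  Since \<open>\<Psi>\<^sub>k \<J> \<Psi>\<^sub>k = 0\<close>, a solution of (S\<open>\<^sub>\<lambda>\<close>) satisfies \<open>\<Psi>\<^sub>k z\<^sub>k = \<Psi>\<^sub>k S\<^sub>k z\<^sub>k\<^sub>+\<^sub>1\<close>.  Hence if
  \<open>\<Psi>\<^sub>k z\<^sub>k = 0\<close> on the interval, the term with \<open>\<lambda>\<close> drops out there and \<open>z\<^sub>k = S\<^sub>k z\<^sub>k\<^sub>+\<^sub>1\<close>, so the
  sequence solves the system on the interval for every other spectral parameter as well.  Positivity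
  of \<open>\<Psi>\<^sub>k\<close> turns a vanishing sum \<open>\<Sum> z\<^sub>k\<^sup>* \<Psi>\<^sub>k z\<^sub>k\<close> into \<open>\<Psi>\<^sub>k z\<^sub>k = 0\<close> for all \<open>k\<close>, and every
  solution is \<open>\<Phi>(\<lambda>) \<xi>\<close> with \<open>\<xi> = z\<close> at \<open>k\<^sub>0\<close>, so all conditions say that the \<open>\<lambda>\<close>-independent space
  of such \<open>\<xi>\<close> is trivial.
\<close>

section \<open>Hermitian inner product and positive semi-definite forms\<close>

definition cinner :: "complex ^ 'n \<Rightarrow> complex ^ 'n \<Rightarrow> complex" where
  "cinner x y = (\<Sum>i\<in>UNIV. cnj (x $ i) * y $ i)"

lemma quad_form_cinner: "quad_form A x = cinner x (A *v x)"
  by (simp add: quad_form_def cinner_def)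

lemma cinner_add_left: "cinner (x + y) z = cinner x z + cinner y z"
  and cinner_add_right: "cinner x (y + z) = cinner x y + cinner x z"
  by (simp_all add: cinner_def algebra_simps sum.distrib)

lemma cinner_scale_left: "cinner (c *s x) y = cnj c * cinner x y"
  and cinner_scale_right: "cinner x (c *s y) = c * cinner x y"
  by (simp_all add: cinner_def algebra_simps sum_distrib_left)

lemma cinner_zero_right [simp]: "cinner x 0 = 0"
  by (simp add: cinner_def)

lemma cinner_sum_right: "cinner x (\<Sum>k\<in>A. f k) = (\<Sum>k\<in>A. cinner x (f k))"
  by (induction A rule: infinite_finite_induct) (simp_all add: cinner_add_right)

lemma cinner_self: "cinner x x = of_real (\<Sum>i\<in>UNIV. (cmod (x $ i))\<^sup>2)"
  by (simp add: cinner_def complex_norm_square mult.commute del: of_real_power)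

lemma cinner_self_eq_0: "cinner x x = 0 \<longleftrightarrow> x = 0"
proof -
  have "cinner x x = 0 \<longleftrightarrow> (\<Sum>i\<in>UNIV. (cmod (x $ i))\<^sup>2) = 0"
    unfolding cinner_self of_real_eq_0_iff ..
  also have "\<dots> \<longleftrightarrow> x = 0"
    by (simp add: sum_nonneg_eq_0_iff vec_eq_iff)
  finally show ?thesis .
qed

lemma cinner_ctranspose: "cinner x (ctranspose B *v y) = cinner (B *v x) y"
proof -
  have "cinner x (ctranspose B *v y)
      = (\<Sum>i\<in>UNIV. \<Sum>j\<in>UNIV. cnj (x $ i) * (cnj (B $ j $ i) * y $ j))"
    by (simp add: cinner_def ctranspose_def matrix_vector_mult_def sum_distrib_left)
  also have "\<dots> = (\<Sum>j\<in>UNIV. \<Sum>i\<in>UNIV. cnj (x $ i) * (cnj (B $ j $ i) * y $ j))"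
    by (rule sum.swap)
  also have "\<dots> = cinner (B *v x) y"
    by (simp add: cinner_def matrix_vector_mult_def sum_distrib_left sum_distrib_right mult_ac)
  finally show ?thesis .
qed

lemma quad_form_congruence:
  "quad_form (ctranspose B ** A ** B) x = quad_form A (B *v x)"
  by (simp add: quad_form_cinner cinner_ctranspose flip: matrix_vector_mul_assoc)

text \<open>
  With \<open>y = A x\<close> and \<open>s\<close> real, \<open>0 \<le> (x + s y)\<^sup>* A (x + s y) = 2 s \<parallel>y\<parallel>\<^sup>2 + s\<^sup>2 y\<^sup>* A y\<close>, which fails for
  small negative \<open>s\<close> unless \<open>y = 0\<close>.
\<close>

lemma pos_semidef_quad_form_eq_0:
  assumes A: "pos_semidef A"
  shows "quad_form A x = 0 \<longleftrightarrow> A *v x = 0"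
proof
  assume x: "quad_form A x = 0"
  define y where "y = A *v x"
  define a where "a = (\<Sum>i\<in>UNIV. (cmod (y $ i))\<^sup>2)"
  define c where "c = Re (quad_form A y)"
  have herm: "cinner u (A *v v) = cinner (A *v u) v" for u v
    using A cinner_ctranspose[of u A v] by (simp add: pos_semidef_def)
  have yy: "cinner y y = of_real a"
    unfolding a_def by (rule cinner_self)
  have xy: "cinner x (A *v y) = of_real a" "cinner y (A *v x) = of_real a"
    by (simp_all only: herm[of x y] yy flip: y_def)
  have a0: "a \<ge> 0" by (simp add: a_def sum_nonneg)
  have c0: "c \<ge> 0" using A by (auto simp: c_def pos_semidef_def less_eq_complex_def)
  have key: "0 \<le> 2 * s * a + s\<^sup>2 * c" for s :: real
  proof -
    let ?w = "x + of_real s *s y"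
    have "quad_form A ?w = quad_form A x + 2 * of_real s * of_real a
        + (of_real s)\<^sup>2 * quad_form A y"
      by (simp add: quad_form_cinner matrix_vector_right_distrib vector_scalar_commute
          cinner_add_left cinner_add_right cinner_scale_left cinner_scale_right xy
          power2_eq_square algebra_simps)
    then have "Re (quad_form A ?w) = 2 * s * a + s\<^sup>2 * c"
      by (simp add: x c_def power2_eq_square)
    moreover have "0 \<le> Re (quad_form A ?w)"
      using A unfolding pos_semidef_def less_eq_complex_def by (metis zero_complex.sel(1))
    ultimately show ?thesis by simp
  qed
  have "a = 0"
  proof (rule ccontr)
    assume "a \<noteq> 0"
    with a0 have "a > 0" by simp
    \<comment> \<open>Taking \<open>c + 1\<close> instead of \<open>c\<close> keeps the denominator
      positive if \<open>c = 0\<close>. At \<open>- s\<close>, \<open>key\<close> gives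
      \<open>2 * a \<le> s * c\<close>, while this choice makes
      \<open>s * c \<le> a\<close>.\<close>
    define s where "s = a / (c + 1)"
    have s: "s > 0" using \<open>a > 0\<close> c0 by (simp add: s_def)
    have "s * (2 * a) \<le> s * (s * c)"
      using key[of "- s"] by (simp add: power2_eq_square)
    then have "2 * a \<le> s * c" using s by (simp only: mult_le_cancel_left_pos)
    also have "s * c \<le> s * (c + 1)" using s by simp
    also have "\<dots> = a" using c0 by (simp add: s_def)
    finally show False using \<open>a > 0\<close> by simp
  qed
  then show "A *v x = 0"
    using cinner_self_eq_0[of y] by (simp add: yy flip: y_def)
qed (simp add: quad_form_cinner)

section \<open>Matrices acting on vectors, and the injectivity of \<open>symp_J\<close>\<close>

lemma cscale_mat_vec: "cscale_mat c A *v x = c *s (A *v x)"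
  by (simp add: cscale_mat_def matrix_vector_mult_def vec_eq_iff sum_distrib_left mult.assoc)

lemma uminus_matrix_vector_mult: "(- A) *v x = - (A *v (x :: complex ^ 'n))"
  by (simp add: matrix_vector_mult_def vec_eq_iff sum_negf)

lemma sum_matrix_vector_mult: "(\<Sum>k\<in>K. f k) *v x = (\<Sum>k\<in>K. f k *v (x :: complex ^ 'n))"
  by (induction K rule: infinite_finite_induct) (simp_all add: matrix_vector_mult_add_rdistrib)

lemma symp_J_Inl: "(symp_J *v x) $ Inl a = x $ Inr a"
  and symp_J_Inr: "(symp_J *v x) $ Inr a = - x $ Inl a"
  unfolding matrix_vector_mult_def symp_J_def UNIV_Plus_UNIV[symmetric] sum.Plus[OF finite finite]
  by (simp_all add: if_distrib if_distribR cong: if_cong)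

lemma symp_J_mult_eq_0: "symp_J *v x = 0 \<longleftrightarrow> x = 0"
proof
  assume 0: "symp_J *v x = 0"
  have "x $ i = 0" for i
    using symp_J_Inl[of x] symp_J_Inr[of x] 0 by (cases i) (auto simp: eq_neg_iff_add_eq_0)
  then show "x = 0" by (simp add: vec_eq_iff)
qed simp

lemma solution_step: "solution S \<Psi> lam z \<Longrightarrow> z k = S_mat S \<Psi> lam k *v z (Suc k)"
  unfolding solution_def by blast

lemma matrix_solution_mult:
  "matrix_solution S \<Psi> lam Z \<Longrightarrow> solution S \<Psi> lam (\<lambda>k. Z k *v x)"
  unfolding matrix_solution_def solution_def by (metis matrix_vector_mul_assoc)

section \<open>Solutions and their dependence on the spectral parameter\<close>

locale symplectic_system =
  fixes S \<Psi> :: "nat \<Rightarrow> 'n::finite mat2"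
  assumes S_symplectic: "\<And>k. ctranspose (S k) ** symp_J ** S k = symp_J"
    and Psi_psd: "\<And>k. pos_semidef (\<Psi> k)"
    and Psi_J_Psi: "\<And>k. \<Psi> k ** symp_J ** \<Psi> k = 0"
begin

lemma S_mat_mult:
  "S_mat S \<Psi> lam k *v x = S k *v x - lam *s (symp_J *v (\<Psi> k *v (S k *v x)))"
  by (simp add: S_mat_def V_mat_def matrix_vector_mult_add_rdistrib cscale_mat_vec
      uminus_matrix_vector_mult vec_eq_iff flip: matrix_vector_mul_assoc)

lemma Psi_J_Psi_mult: "\<Psi> k *v (symp_J *v (\<Psi> k *v x)) = 0"
  using arg_cong[OF Psi_J_Psi[of k], of "\<lambda>A. A *v x"] by (simp flip: matrix_vector_mul_assoc)

lemma Psi_S_mat: "\<Psi> k *v (S_mat S \<Psi> lam k *v x) = \<Psi> k *v (S k *v x)"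
  by (simp add: S_mat_mult matrix_vector_mult_diff_distrib Psi_J_Psi_mult
      vector_scalar_commute)

lemma S_mat_eq_S: "\<Psi> k *v (S_mat S \<Psi> lam k *v x) = 0 \<Longrightarrow> S_mat S \<Psi> lam k *v x = S k *v x"
  unfolding Psi_S_mat by (simp add: S_mat_mult)

text \<open>The zero image is annihilated by \<open>\<Psi> k\<close>, so the spectral term drops out
  and \<open>S k *v x = 0\<close>. The symplectic identity then gives
  \<open>symp_J *v x = 0\<close>.\<close>

lemma S_mat_mult_eq_0:
  assumes "S_mat S \<Psi> lam k *v x = 0"
  shows "x = 0"
proof -
  have "S k *v x = 0"
    using S_mat_eq_S[of k lam x] assms by simp
  then have "symp_J *v x = 0"
    using arg_cong[OF S_symplectic[of k], of "\<lambda>A. A *v x"]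
    by (simp flip: matrix_vector_mul_assoc)
  then show ?thesis by (simp add: symp_J_mult_eq_0)
qed

lemma S_mat_cancel: "S_mat S \<Psi> lam k *v x = S_mat S \<Psi> lam k *v y \<Longrightarrow> x = y"
  using S_mat_mult_eq_0[of lam k "x - y"] by (simp add: matrix_vector_mult_diff_distrib)

text \<open>Towards smaller indices the recursion itself propagates equality; towards larger ones
  \<open>S_mat_cancel\<close> does. Requiring the recursion only on \<open>I\<close> admits
  sequences that may violate it elsewhere.\<close>

lemma solution_unique_on:
  assumes z: "\<And>k. k \<in> I \<Longrightarrow> z k = S_mat S \<Psi> lam k *v z (Suc k)"
    and w: "\<And>k. k \<in> I \<Longrightarrow> w k = S_mat S \<Psi> lam k *v w (Suc k)"
    and I: "\<And>i j k. i \<in> I \<Longrightarrow> k \<in> I \<Longrightarrow> i \<le> j \<Longrightarrow> j \<le> k \<Longrightarrow> j \<in> I"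
    and k0: "k0 \<in> I" and k: "k \<in> I" and eq: "z k0 = w k0"
  shows "z k = w k"
proof (cases "k0 \<le> k")
  case True
  then show ?thesis
  proof (induction k rule: dec_induct)
    case (step m)
    then have "m \<in> I" using I[OF k0 k] by simp
    then show ?case using step.IH z w S_mat_cancel by metis
  qed (rule eq)
next
  case False
  then have "k \<le> k0" by simp
  then show ?thesis
  proof (induction k rule: inc_induct)
    case (step m)
    then have "m \<in> I" using I[OF k k0] by simp
    then show ?case using step.IH z w by metis
  qed (rule eq)
qed

lemma solution_unique:
  assumes "solution S \<Psi> lam z" "solution S \<Psi> lam w" "z k0 = w k0"
  shows "z k = w k"
  using assms by (intro solution_unique_on[of UNIV z lam w k0 k]) (auto intro: solution_step)

text \<open>On \<open>I\<close> the sequence \<open>z\<close> also obeys the recursion for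
  \<open>nu\<close>, so uniqueness on \<open>I\<close> identifies it with \<open>w\<close>. Nothing
  is claimed outside \<open>I\<close>.\<close>

lemma null_solution_independent:
  assumes z: "solution S \<Psi> lam z" and null: "\<And>k. k \<in> I \<Longrightarrow> \<Psi> k *v z k = 0"
    and w: "solution S \<Psi> nu w"
    and I: "\<And>i j k. i \<in> I \<Longrightarrow> k \<in> I \<Longrightarrow> i \<le> j \<Longrightarrow> j \<le> k \<Longrightarrow> j \<in> I"
    and k0: "k0 \<in> I" and k: "k \<in> I" and eq: "w k0 = z k0"
  shows "w k = z k"
proof (rule solution_unique_on[where z = w and w = z and lam = nu, OF _ _ I k0 k eq])
  fix j assume j: "j \<in> I"
  show "w j = S_mat S \<Psi> nu j *v w (Suc j)"
    using w by (rule solution_step)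
  have zj: "z j = S_mat S \<Psi> lam j *v z (Suc j)"
    using z by (rule solution_step)
  have "\<Psi> j *v (S j *v z (Suc j)) = 0"
    using null[OF j] by (simp add: zj Psi_S_mat)
  then show "z j = S_mat S \<Psi> nu j *v z (Suc j)"
    by (simp add: zj S_mat_mult)
qed

lemma sum_quad_form_nonneg: "(\<Sum>k\<in>I. quad_form (\<Psi> k) (z k)) \<ge> 0"
  using Psi_psd by (intro sum_nonneg) (simp add: pos_semidef_def)

lemma sum_quad_form_eq_0:
  assumes "finite I"
  shows "(\<Sum>k\<in>I. quad_form (\<Psi> k) (z k)) = 0 \<longleftrightarrow> (\<forall>k\<in>I. \<Psi> k *v z k = 0)"
  using assms Psi_psd
  by (subst sum_nonneg_eq_0_iff) (auto simp: pos_semidef_quad_form_eq_0, simp add: pos_semidef_def)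

text \<open>Pairing the kernel equation with \<open>x\<close> yields a vanishing sum of nonnegative
  forms, whose terms must all be zero.\<close>

lemma phi_mat_mult_eq_0:
  assumes "finite I"
  shows "phi_mat \<Psi> \<Phi> lam I *v x = 0 \<longleftrightarrow> (\<forall>k\<in>I. \<Psi> k *v (\<Phi> lam k *v x) = 0)"
proof
  assume "phi_mat \<Psi> \<Phi> lam I *v x = 0"
  then have "cinner x (phi_mat \<Psi> \<Phi> lam I *v x) = 0" by simp
  then have "(\<Sum>k\<in>I. quad_form (\<Psi> k) (\<Phi> lam k *v x)) = 0"
    by (simp add: phi_mat_def sum_matrix_vector_mult cinner_sum_right quad_form_congruence
        flip: quad_form_cinner)
  then show "\<forall>k\<in>I. \<Psi> k *v (\<Phi> lam k *v x) = 0"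
    by (simp only: sum_quad_form_eq_0[OF assms])
next
  assume "\<forall>k\<in>I. \<Psi> k *v (\<Phi> lam k *v x) = 0"
  then show "phi_mat \<Psi> \<Phi> lam I *v x = 0"
    by (simp add: phi_mat_def sum_matrix_vector_mult flip: matrix_vector_mul_assoc)
qed

end

section \<open>Rank versus kernel, and discrete intervals of naturals\<close>

lemma rank_eq_card_iff_ker:
  fixes A :: "'a::field ^ 'n ^ 'm"
  shows "rank A = CARD('n) \<longleftrightarrow> {x. A *v x = 0} = {0}"
proof -
  have "rank A = CARD('n) \<longleftrightarrow> vec.span (rows A) = UNIV"
    by (simp add: row_rank_def_gen vec.dim_eq_full[symmetric] card_cart_basis vec.dimension_def)
  \<comment> \<open>Spanning rows amount to a left inverse, which exists exactly when the kernel is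
    trivial.\<close>
  also have "\<dots> \<longleftrightarrow> (\<forall>x. A *v x = 0 \<longrightarrow> x = 0)"
    by (simp add: matrix_left_invertible_span_rows_gen[symmetric] matrix_left_invertible_ker)
  also have "\<dots> \<longleftrightarrow> {x. A *v x = 0} = {0}" by auto
  finally show ?thesis .
qed

lemma discrete_interval_nat_convex:
  assumes "discrete_interval (int ` I)" "i \<in> I" "k \<in> I" "i \<le> j" "j \<le> k"
  shows "j \<in> I"
proof -
  obtain R :: "real set" where R: "is_interval R" "int ` I = {k. real_of_int k \<in> R}"
    using assms(1) by (auto simp: discrete_interval_def)
  have iff: "real m \<in> R \<longleftrightarrow> m \<in> I" for m
    using R(2) by (metis inj_image_mem_iff inj_of_nat mem_Collect_eq of_int_of_nat_eq)
  have "real j \<in> R"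
    using R(1) assms iff unfolding is_interval_1 by (meson of_nat_le_iff)
  then show ?thesis by (simp add: iff)
qed

theorem theorem3p9:
  fixes S \<Psi> :: "nat \<Rightarrow> 'n::finite mat2"
    and \<Phi> :: "complex \<Rightarrow> nat \<Rightarrow> 'n mat2"
    and k0 :: nat and I :: "nat set" and \<mu> :: complex
  assumes S_symplectic: "\<And>k. ctranspose (S k) ** symp_J ** S k = symp_J"
    and Psi_psd: "\<And>k. pos_semidef (\<Psi> k)"
    and Psi_J_Psi: "\<And>k. \<Psi> k ** symp_J ** \<Psi> k = 0"
    and Phi_solution: "\<And>lam. matrix_solution S \<Psi> lam (\<Phi> lam)"
    and Phi_init: "\<And>lam. \<Phi> lam k0 = mat 1"
    and I_interval: "discrete_interval (int ` I)"
    and I_finite: "finite I"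
    and k0_in_I: "k0 \<in> I"
  shows
    "(rank (phi_mat \<Psi> \<Phi> \<mu> I) = 2 * CARD('n)
        \<longleftrightarrow> {\<xi>. phi_mat \<Psi> \<Phi> \<mu> I *v \<xi> = 0} = {0}) \<and>
     ({\<xi>. phi_mat \<Psi> \<Phi> \<mu> I *v \<xi> = 0} = {0}
        \<longleftrightarrow> (\<exists>lam. \<forall>z. solution S \<Psi> lam z \<and> (\<exists>k. z k \<noteq> 0)
               \<longrightarrow> (\<Sum>k\<in>I. quad_form (\<Psi> k) (z k)) > 0)) \<and>
     ((\<exists>lam. \<forall>z. solution S \<Psi> lam z \<and> (\<exists>k. z k \<noteq> 0)
               \<longrightarrow> (\<Sum>k\<in>I. quad_form (\<Psi> k) (z k)) > 0)
        \<longleftrightarrow> (\<exists>lam. \<forall>z. solution S \<Psi> lam z \<and> (\<Sum>k\<in>I. quad_form (\<Psi> k) (z k)) = 0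
               \<longrightarrow> (\<forall>k\<in>I. z k = 0)))"
proof -
  interpret symplectic_system S \<Psi>
    by unfold_locales (fact S_symplectic Psi_psd Psi_J_Psi)+
  note I_convex = discrete_interval_nat_convex[OF I_interval]
  note Phi_sol = matrix_solution_mult[OF Phi_solution]
  let ?Q = "\<lambda>z. \<Sum>k\<in>I. quad_form (\<Psi> k) (z k)"
  \<comment> \<open>The zero solution used for comparison is \<open>\<Phi> lam\<close> applied to
    the vector \<open>0\<close>.\<close>
  have trivial: "z k = 0" if "solution S \<Psi> lam z" "z k0 = 0" for lam z k
    using solution_unique[OF that(1) Phi_sol[of lam 0], of k0 k] that(2) by simp
  have pos: "?Q z > 0 \<longleftrightarrow> ?Q z \<noteq> 0" for z
    using sum_quad_form_nonneg[of z I] by (auto simp: order.strict_iff_order)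
  have "rank (phi_mat \<Psi> \<Phi> \<mu> I) = 2 * CARD('n)
      \<longleftrightarrow> {\<xi>. phi_mat \<Psi> \<Phi> \<mu> I *v \<xi> = 0} = {0}"
    using rank_eq_card_iff_ker[of "phi_mat \<Psi> \<Phi> \<mu> I"] by (simp add: mult_2)
  moreover have "\<forall>k\<in>I. z k = 0"
    if "solution S \<Psi> lam z" "?Q z = 0"
      "\<forall>z. solution S \<Psi> lam z \<and> (\<exists>k. z k \<noteq> 0) \<longrightarrow> ?Q z > 0" for lam z
    using that unfolding pos by blast
  \<comment> \<open>From (iv) to (iii) with the same \<open>lam\<close>: vanishing on
    \<open>I\<close> includes \<open>k0\<close>, so \<open>trivial\<close> gives vanishing
    everywhere.\<close>
  moreover have "?Q z > 0"
    if "solution S \<Psi> lam z" "\<exists>k. z k \<noteq> 0"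
      "\<forall>z. solution S \<Psi> lam z \<and> ?Q z = 0 \<longrightarrow> (\<forall>k\<in>I. z k = 0)" for lam z
    using that k0_in_I trivial[OF that(1)] unfolding pos by blast
  \<comment> \<open>From (ii) to (iii), with \<open>\<mu>\<close> as the witness for
    \<open>lam\<close>.\<close>
  moreover have "?Q z > 0"
    if ker: "{\<xi>. phi_mat \<Psi> \<Phi> \<mu> I *v \<xi> = 0} = {0}"
      and z: "solution S \<Psi> \<mu> z" and nz: "\<exists>k. z k \<noteq> 0" for z
  proof -
    have z_eq: "\<Phi> \<mu> k *v z k0 = z k" for k
      using solution_unique[OF Phi_sol[of \<mu> "z k0"] z, of k0 k] by (simp add: Phi_init)
    have "z k0 = 0" if "?Q z = 0"
    proof -
      have "phi_mat \<Psi> \<Phi> \<mu> I *v z k0 = 0"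
        using that unfolding phi_mat_mult_eq_0[OF I_finite] sum_quad_form_eq_0[OF I_finite] z_eq .
      then show ?thesis using ker by blast
    qed
    then show ?thesis using nz trivial[OF z] unfolding pos by blast
  qed
  moreover have "{\<xi>. phi_mat \<Psi> \<Phi> \<mu> I *v \<xi> = 0} = {0}"
    if lam: "\<forall>z. solution S \<Psi> lam z \<and> (\<exists>k. z k \<noteq> 0) \<longrightarrow> ?Q z > 0" for lam
  proof -
    have "\<xi> = 0" if "phi_mat \<Psi> \<Phi> \<mu> I *v \<xi> = 0" for \<xi>
    proof -
      have null: "\<Psi> k *v (\<Phi> \<mu> k *v \<xi>) = 0" if "k \<in> I" for k
        using \<open>phi_mat \<Psi> \<Phi> \<mu> I *v \<xi> = 0\<close> that by (simp add: phi_mat_mult_eq_0[OF I_finite])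
      \<comment> \<open>Since (iii) supplies some \<open>lam\<close> unrelated to
        \<open>\<mu>\<close>, the kernel vector \<open>\<xi>\<close> must be carried over from
        \<open>\<mu>\<close> to \<open>lam\<close>.\<close>
      have "\<Phi> lam k *v \<xi> = \<Phi> \<mu> k *v \<xi>" if "k \<in> I" for k
        by (rule null_solution_independent[where z = "\<lambda>k. \<Phi> \<mu> k *v \<xi>",
              OF Phi_sol null Phi_sol I_convex k0_in_I that])
          (simp_all add: Phi_init)
      then have "?Q (\<lambda>k. \<Phi> lam k *v \<xi>) = 0"
        unfolding sum_quad_form_eq_0[OF I_finite] by (simp add: null)
      then have "\<Phi> lam k0 *v \<xi> = 0"
        using lam Phi_sol[of lam \<xi>] unfolding pos by blast
      then show ?thesis by (simp add: Phi_init)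
    qed
    then show ?thesis by auto
  qed
  ultimately show ?thesis by meson
qed

end
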